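(* Let $\langle S,F\rangle$ be a non-paradoxical $\mathcal{F}$-system and let $x\in S$. Then: (i) $x$ is a referential contradiction if and only if $x\notin A$ for every conglomerate $A$ of $\langle S,F\rangle$; and (ii) $x$ is a referential tautology if and only if $x\in A$ for every conglomerate $A$ of $\langle S,F\rangle$.
   Context: An $\mathcal{F}$-system is a pair $\langle S, F\rangle$ where $S$ is a set (its elements are called sentences) and $F\subseteq S\times S$ is a binary relation. For $x\in S$ put $\overrightarrow{F}(x)=\{y\in S: (x,y)\in F\}$ and $\overleftarrow{F}(x)=\{y\in S:(y,x)\in F\}$; for $A\subseteq S$ put $\overrightarrow{F}(A)=\bigcup_{x\in A}\overrightarrow{F}(x)$ and $\overleftarrow{F}(A)=\bigcup_{x\in A}\overleftarrow{F}(x)$. A sentence $x$ is a sink if $\overrightarrow{F}(x)=\emptyset$, and $sinks(A)=\{x\in A: x\text{ is a sink}\}$. A labelling on $\langle S,F\rangle$ is a total function $L:S\to\{\mathtt{T},\mathtt{F},\mathtt{U}\}$ (three distinct labels) such that for all $x\in S\setminus sinks(S)$: (a) $L(x)=\mathtt{F}$ iff $L(z)=\mathtt{T}$ for some $z\in\overrightarrow{F}(x)$; and (b) $L(x)=\mathtt{T}$ iff $L(z)=\mathtt{F}$ for every $z\in\overrightarrow{F}(x)$. (Labels of sinks are unrestricted.) A labelling $L$ is classical iff $L(x)\neq\mathtt{U}$ for every $x\in S$. An $\mathcal{F}$-system is paradoxical iff it has no classical labellings. A sentence $x\in S$ is a referential contradiction iff $L(x)=\mathtt{F}$ for every classical labelling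 $L$, and a referential tautology iff $L(x)=\mathtt{T}$ for every classical labelling $L$. A conglomerate of $\langle S,F\rangle$ is a subset $A\subseteq S$ such that (1) $\overleftarrow{F}(A)\subseteq S\setminus A$, and (2) $(S\setminus A)\setminus sinks(S)\subseteq\overleftarrow{F}(A)$. *)

theory Defs
  imports Main
begin

text \<open>
  For \<open>F \<subseteq> S \<times> S\<close>, the forward and backward images of \<open>A\<close> are the relational images
  \<open>F `` A\<close> and \<open>F\<inverse> `` A\<close>. They are subsets of \<open>S\<close> because \<open>F \<subseteq> S \<times> S\<close>.
\<close>

definition F_system :: "'a set \<Rightarrow> 'a rel \<Rightarrow> bool" where
  "F_system S F \<longleftrightarrow> F \<subseteq> S \<times> S"

definition sink :: "'a rel \<Rightarrow> 'a \<Rightarrow> bool" where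
  "sink F x \<longleftrightarrow> F `` {x} = {}"

definition sinks :: "'a rel \<Rightarrow> 'a set \<Rightarrow> 'a set" where
  "sinks F A = {x \<in> A. sink F x}"

datatype label = TT | FF | UU

text \<open>
  A labelling of \<open>S\<close> is represented by a function on the whole type. Its values outside \<open>S\<close>
  are unconstrained and are never consulted when \<open>F \<subseteq> S \<times> S\<close>.
\<close>

definition labelling :: "'a set \<Rightarrow> 'a rel \<Rightarrow> ('a \<Rightarrow> label) \<Rightarrow> bool" where
  "labelling S F L \<longleftrightarrow>
     (\<forall>x \<in> S - sinks F S.
        (L x = FF \<longleftrightarrow> (\<exists>z \<in> F `` {x}. L z = TT)) \<and>
        (L x = TT \<longleftrightarrow> (\<forall>z \<in> F `` {x}. L z = FF)))"

definition classical_labelling :: "'a set \<Rightarrow> 'a rel \<Rightarrow> ('a \<Rightarrow> label) \<Rightarrow> bool" where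
  "classical_labelling S F L \<longleftrightarrow> labelling S F L \<and> (\<forall>x \<in> S. L x \<noteq> UU)"

definition paradoxical :: "'a set \<Rightarrow> 'a rel \<Rightarrow> bool" where
  "paradoxical S F \<longleftrightarrow> \<not> (\<exists>L. classical_labelling S F L)"

definition referential_contradiction :: "'a set \<Rightarrow> 'a rel \<Rightarrow> 'a \<Rightarrow> bool" where
  "referential_contradiction S F x \<longleftrightarrow> x \<in> S \<and> (\<forall>L. classical_labelling S F L \<longrightarrow> L x = FF)"

definition referential_tautology :: "'a set \<Rightarrow> 'a rel \<Rightarrow> 'a \<Rightarrow> bool" where
  "referential_tautology S F x \<longleftrightarrow> x \<in> S \<and> (\<forall>L. classical_labelling S F L \<longrightarrow> L x = TT)"

definition conglomerate :: "'a set \<Rightarrow> 'a rel \<Rightarrow> 'a set \<Rightarrow> bool" where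
  "conglomerate S F A \<longleftrightarrow>
     A \<subseteq> S \<and> F\<inverse> `` A \<subseteq> S - A \<and> (S - A) - sinks F S \<subseteq> F\<inverse> `` A"

end

theory Submission
  imports Defs
begin

text \<open>
  Classical labellings and conglomerates determine each other: the true sentences of a classical
  labelling form a conglomerate, and the two-valued indicator of a conglomerate is a classical
  labelling.
\<close>

text \<open>A sentence pointing at a true one is not a sink, so the clause for \<open>FF\<close>
  makes it false, hence outside the set. A non-sink that is not true is false, since
  \<open>UU\<close> is excluded, and the same clause then supplies a true successor.\<close>

lemma conglomerate_true_sentences:
  assumes "F_system S F" and "classical_labelling S F L"
  shows "conglomerate S F {y \<in> S. L y = TT}"
proof -
  have FS: "F \<subseteq> S \<times> S"
    using assms(1) by (simp add: F_system_def)
  have false_iff: "L y = FF \<longleftrightarrow> (\<exists>z \<in> F `` {y}. L z = TT)" if "y \<in> S" "\<not> sink F y" for y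
    using assms(2) that by (auto simp: classical_labelling_def labelling_def sinks_def)
  have two_valued: "L y = TT \<or> L y = FF" if "y \<in> S" for y
    using assms(2) that by (cases "L y") (auto simp: classical_labelling_def)
  have "y \<in> S \<and> L y = FF" if "(y, z) \<in> F" "L z = TT" for y z
    using FS that false_iff[of y] by (auto simp: sink_def)
  moreover have "\<exists>z \<in> S. (y, z) \<in> F \<and> L z = TT" if "y \<in> S" "L y \<noteq> TT" "\<not> sink F y" for y
    using FS that false_iff[of y] two_valued[of y] by auto
  ultimately show ?thesis
    by (fastforce simp: conglomerate_def sinks_def)
qed

text \<open>Off the sinks, the two inclusions say together that a sentence lies outside
  \<open>A\<close> exactly when some successor lies in \<open>A\<close>. This is the clause for
  \<open>FF\<close>; negating both sides gives the clause for \<open>TT\<close>.\<close>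

lemma classical_labelling_indicator:
  assumes "conglomerate S F A"
  shows "classical_labelling S F (\<lambda>y. if y \<in> A then TT else FF)"
proof -
  have "y \<notin> A \<longleftrightarrow> (\<exists>z \<in> F `` {y}. z \<in> A)" if "y \<in> S - sinks F S" for y
    using assms that unfolding conglomerate_def by blast
  then show ?thesis
    by (auto simp: classical_labelling_def labelling_def)
qed

theorem proposition1:
  fixes S :: "'a set" and F :: "'a rel" and x :: 'a
  assumes "F_system S F"
    and "\<not> paradoxical S F"
    and "x \<in> S"
  shows "(referential_contradiction S F x \<longleftrightarrow> (\<forall>A. conglomerate S F A \<longrightarrow> x \<notin> A)) \<and>
         (referential_tautology S F x \<longleftrightarrow> (\<forall>A. conglomerate S F A \<longrightarrow> x \<in> A))"
proof -
  \<comment> \<open>Only the value at \<open>x\<close> is kept; \<open>x \<in> S\<close> makes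
    membership in the set of true sentences the same as truth.\<close>
  have from_labelling: "\<exists>A. conglomerate S F A \<and> (x \<in> A \<longleftrightarrow> L x = TT)"
    if "classical_labelling S F L" for L
    using conglomerate_true_sentences[OF assms(1) that] assms(3) by blast
  have to_labelling: "\<exists>L. classical_labelling S F L \<and> L x = (if x \<in> A then TT else FF)"
    if "conglomerate S F A" for A
    using classical_labelling_indicator[OF that] by blast
  \<comment> \<open>A conglomerate avoiding \<open>x\<close> only shows that \<open>x\<close> is not
    true; this turns that into falsity for the contradiction case.\<close>
  have two_valued: "L x = FF \<longleftrightarrow> L x \<noteq> TT" if "classical_labelling S F L" for L
    using that assms(3) by (cases "L x") (auto simp: classical_labelling_def)
  have "referential_contradiction S F x \<longleftrightarrow> (\<forall>A. conglomerate S F A \<longrightarrow> x \<notin> A)"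
    unfolding referential_contradiction_def
    using assms(3) from_labelling to_labelling two_valued by (metis label.distinct(1))
  moreover have "referential_tautology S F x \<longleftrightarrow> (\<forall>A. conglomerate S F A \<longrightarrow> x \<in> A)"
    unfolding referential_tautology_def
    using assms(3) from_labelling to_labelling by (metis label.distinct(1))
  ultimately show ?thesis ..
qed

end
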